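(* Let $X$ and $Y$ be coarse spaces and let $f\colon X\to Y$ be a map. The following are equivalent: (1) $f$ is bornologous; (2) for any $x,y\in{}^{\ast}X$, $x\sim_{X}y$ implies ${}^{\ast}f(x)\sim_{Y}{}^{\ast}f(y)$; (3) for any $x\in{}^{\ast}X$, ${}^{\ast}f\left(G_{X}^{c}(x)\right)\subseteq G_{Y}^{c}\left({}^{\ast}f(x)\right)$.
   Context: Nonstandard setting: fix a transitive universe $\mathbb{U}$ (the standard universe) satisfying sufficiently many axioms of ZFC and containing all standard objects considered, and a $|\mathbb{U}|^{+}$-saturated enlargement $\ast\colon\mathbb{U}\hookrightarrow{}^{\ast}\mathbb{U}$ (so transfer, i.e. elementary extension, and saturation are available). A standard set $X$ is regarded as a subset of ${}^{\ast}X$ by identifying $x$ with ${}^{\ast}x$. A coarse structure on a set $X$ is a family $\mathcal{C}_{X}\subseteq\mathcal{P}(X\times X)$ which contains the diagonal $\Delta_{X}$ and is closed under taking subsets, finite unions, compositions $E\circ F$ of relations, and inverses $E^{-1}$. The pair $(X,\mathcal{C}_{X})$ is a coarse space; elements of $\mathcal{C}_{X}$ are called controlled sets. The finite closeness relation of a coarse space $X$ is the relation $\sim_{X}$ on ${}^{\ast}X$ given by ${\sim_{X}}=\bigcup_{E\in\mathcal{C}_{X}}{}^{\ast}E$. For $x\in{}^{\ast}X$ the coarse galaxy of $x$ is $G_{X}^{c}(x)=\{y\in{}^{\ast}X: x\sim_{X}y\}$. A map $f\colon X\to Y$ between coarse spaces is bornologous if $\{(f(x),f(y)):(x,y)\in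 E\}\in\mathcal{C}_{Y}$ for every $E\in\mathcal{C}_{X}$. *)

theory Defs
  imports Main "HOL-Library.Equipollence"
begin

section \<open>First-order formulas in the language of set theory\<close>

text \<open>
  A structure for the language of set theory is a type together with a binary relation on it;
  variables are named by natural numbers.
\<close>

datatype fm =
    Mem nat nat
  | Equ nat nat
  | Neg fm
  | Conj fm fm
  | Ex nat fm

primrec sat :: "('u \<Rightarrow> 'u \<Rightarrow> bool) \<Rightarrow> (nat \<Rightarrow> 'u) \<Rightarrow> fm \<Rightarrow> bool" where
  "sat mem v (Mem i j) \<longleftrightarrow> mem (v i) (v j)"
| "sat mem v (Equ i j) \<longleftrightarrow> v i = v j"
| "sat mem v (Neg \<phi>) \<longleftrightarrow> \<not> sat mem v \<phi>"
| "sat mem v (Conj \<phi> \<psi>) \<longleftrightarrow> sat mem v \<phi> \<and> sat mem v \<psi>"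
| "sat mem v (Ex i \<phi>) \<longleftrightarrow> (\<exists>a. sat mem (v(i := a)) \<phi>)"

section \<open>Standard universe and saturated enlargement\<close>

text \<open>
  HOL has no ambient set-theoretic membership, so a transitive universe is given up to isomorphism
  (Mostowski collapse): its elements form a type, and membership restricted to it is a well-founded
  extensional relation.  Of the axioms of ZFC only pairing, union and the separation schema are
  required besides extensionality and foundation; universes satisfying further axioms are included.
\<close>

locale standard_universe =
  fixes mem :: "'u \<Rightarrow> 'u \<Rightarrow> bool"
  assumes foundation: "wfp mem"
    and extensionality: "(\<And>z. mem z a \<longleftrightarrow> mem z b) \<Longrightarrow> a = b"
    and pairing: "\<exists>c. \<forall>z. mem z c \<longleftrightarrow> z = a \<or> z = b"
    and union: "\<exists>c. \<forall>z. mem z c \<longleftrightarrow> (\<exists>b. mem b a \<and> mem z b)"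
    and separation: "\<exists>c. \<forall>z. mem z c \<longleftrightarrow> mem z a \<and> sat mem (v(i := z)) \<phi>"

text \<open>
  Saturation at the successor of the cardinality of the universe, in the form usual in nonstandard
  analysis: every family of at most that many internal sets (elements of the enlargement) with the
  finite intersection property has a common element.  In particular the extension is an enlargement.
\<close>

locale saturated_enlargement = standard_universe mem
  for mem :: "'u \<Rightarrow> 'u \<Rightarrow> bool" +
  fixes smem :: "'v \<Rightarrow> 'v \<Rightarrow> bool"
    and star :: "'u \<Rightarrow> 'v"
  assumes transfer: "sat mem v \<phi> \<longleftrightarrow> sat smem (star \<circ> v) \<phi>"
    and saturation:
      "\<lbrakk>\<A> \<lesssim> (UNIV :: 'u set);
        \<And>\<F>. \<lbrakk>\<F> \<subseteq> \<A>; finite \<F>\<rbrakk> \<Longrightarrow> \<exists>p. \<forall>A\<in>\<F>. smem p A\<rbrakk>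
       \<Longrightarrow> \<exists>p. \<forall>A\<in>\<A>. smem p A"

section \<open>Sets, relations and maps that are elements of a universe\<close>

definition ext :: "('u \<Rightarrow> 'u \<Rightarrow> bool) \<Rightarrow> 'u \<Rightarrow> 'u set" where
  "ext mem a = {z. mem z a}"

definition is_upair :: "('u \<Rightarrow> 'u \<Rightarrow> bool) \<Rightarrow> 'u \<Rightarrow> 'u \<Rightarrow> 'u \<Rightarrow> bool" where
  "is_upair mem c a b \<longleftrightarrow> (\<forall>z. mem z c \<longleftrightarrow> z = a \<or> z = b)"

text \<open>Kuratowski pairs: \<open>p = {{a}, {a, b}}\<close>.\<close>

definition is_pair :: "('u \<Rightarrow> 'u \<Rightarrow> bool) \<Rightarrow> 'u \<Rightarrow> 'u \<Rightarrow> 'u \<Rightarrow> bool" where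
  "is_pair mem p a b \<longleftrightarrow> (\<forall>z. mem z p \<longleftrightarrow> is_upair mem z a a \<or> is_upair mem z a b)"

definition is_relation :: "('u \<Rightarrow> 'u \<Rightarrow> bool) \<Rightarrow> 'u \<Rightarrow> bool" where
  "is_relation mem r \<longleftrightarrow> (\<forall>p. mem p r \<longrightarrow> (\<exists>a b. is_pair mem p a b))"

definition rel_of :: "('u \<Rightarrow> 'u \<Rightarrow> bool) \<Rightarrow> 'u \<Rightarrow> ('u \<times> 'u) set" where
  "rel_of mem r = {(a, b). \<exists>p. mem p r \<and> is_pair mem p a b}"

definition is_map :: "('u \<Rightarrow> 'u \<Rightarrow> bool) \<Rightarrow> 'u \<Rightarrow> 'u \<Rightarrow> 'u \<Rightarrow> bool" where
  "is_map mem f X Y \<longleftrightarrow>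
     is_relation mem f \<and> rel_of mem f \<subseteq> ext mem X \<times> ext mem Y \<and>
     (\<forall>x\<in>ext mem X. \<exists>!y. (x, y) \<in> rel_of mem f)"

definition app :: "('u \<Rightarrow> 'u \<Rightarrow> bool) \<Rightarrow> 'u \<Rightarrow> 'u \<Rightarrow> 'u" where
  "app mem f x = (THE y. (x, y) \<in> rel_of mem f)"

section \<open>Coarse spaces\<close>

definition coarse_structure :: "'a set \<Rightarrow> ('a \<times> 'a) set set \<Rightarrow> bool" where
  "coarse_structure X \<C> \<longleftrightarrow>
     \<C> \<subseteq> Pow (X \<times> X) \<and>
     Id_on X \<in> \<C> \<and>
     (\<forall>E\<in>\<C>. \<forall>F. F \<subseteq> E \<longrightarrow> F \<in> \<C>) \<and>
     (\<forall>\<F>. \<F> \<subseteq> \<C> \<and> finite \<F> \<longrightarrow> \<Union>\<F> \<in> \<C>) \<and>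
     (\<forall>E\<in>\<C>. \<forall>F\<in>\<C>. E O F \<in> \<C>) \<and>
     (\<forall>E\<in>\<C>. E\<inverse> \<in> \<C>)"

definition bornologous ::
  "('a \<times> 'a) set set \<Rightarrow> ('b \<times> 'b) set set \<Rightarrow> ('a \<Rightarrow> 'b) \<Rightarrow> bool" where
  "bornologous \<C> \<D> f \<longleftrightarrow> (\<forall>E\<in>\<C>. {(f x, f y) | x y. (x, y) \<in> E} \<in> \<D>)"

text \<open>
  For an element \<open>C\<close> of the universe, the family of relations that it is as a set.
  In \<open>coarse_space\<close>, closure under subsets refers to all subsets, not just to those known
  to belong to the universe.
\<close>

definition controlled :: "('u \<Rightarrow> 'u \<Rightarrow> bool) \<Rightarrow> 'u \<Rightarrow> ('u \<times> 'u) set set" where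
  "controlled mem C = rel_of mem ` ext mem C"

definition coarse_space :: "('u \<Rightarrow> 'u \<Rightarrow> bool) \<Rightarrow> 'u \<Rightarrow> 'u \<Rightarrow> bool" where
  "coarse_space mem X C \<longleftrightarrow>
     (\<forall>E\<in>ext mem C. is_relation mem E) \<and> coarse_structure (ext mem X) (controlled mem C)"

definition finitely_close ::
  "('u \<Rightarrow> 'u \<Rightarrow> bool) \<Rightarrow> ('v \<Rightarrow> 'v \<Rightarrow> bool) \<Rightarrow> ('u \<Rightarrow> 'v) \<Rightarrow> 'u \<Rightarrow> ('v \<times> 'v) set" where
  "finitely_close mem smem star C = (\<Union>E\<in>ext mem C. rel_of smem (star E))"

definition coarse_galaxy ::
  "('u \<Rightarrow> 'u \<Rightarrow> bool) \<Rightarrow> ('v \<Rightarrow> 'v \<Rightarrow> bool) \<Rightarrow> ('u \<Rightarrow> 'v) \<Rightarrow> 'u \<Rightarrow> 'u \<Rightarrow> 'v \<Rightarrow> 'v set" where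
  "coarse_galaxy mem smem star X C x =
     {y \<in> ext smem (star X). (x, y) \<in> finitely_close mem smem star C}"

end

theory Submission
  imports Defs
begin

text \<open>
  Write \<open>f\<inverse> O E O f\<close> for the image of a relation \<open>E\<close> under the graph of \<open>f\<close>, so that \<open>f\<close> is
  bornologous iff each controlled \<open>E\<close> has a controlled image.

  If the image of \<open>E\<close> is a controlled set \<open>F\<close>, the inclusion \<open>f\<inverse> O E O f \<subseteq> F\<close> is a first-order
  statement about \<open>f\<close>, \<open>E\<close>, \<open>F\<close>, and its transfer (\<open>star_image_subset_iff\<close>) says that the extension
  of \<open>f\<close> carries \<open>*E\<close>-related points to \<open>*F\<close>-related points; hence it preserves finite closeness.

  Conversely, suppose the image of \<open>E\<close> is not controlled.  As controlled sets are closed under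
  subsets, for each controlled \<open>F\<close> the set \<open>A F\<close> of pairs in \<open>E\<close> whose image avoids \<open>F\<close> is nonempty;
  as they are closed under finite unions, the sets \<open>A F\<close> have the finite intersection property.
  Saturation (\<open>uniform_escape\<close>) gives a single pair in every \<open>*(A F)\<close>.  Its two entries are \<open>*E\<close>-related, but their images
  are \<open>*F\<close>-related for no controlled \<open>F\<close>, so that finite closeness is not preserved.

  The statement about galaxies is the pointwise form of preservation, because the extension of \<open>f\<close>
  maps into \<open>*Y\<close>.
\<close>

section \<open>Formulas for pairs, relations and maps\<close>

abbreviation "Disj \<phi> \<psi> \<equiv> Neg (Conj (Neg \<phi>) (Neg \<psi>))"
abbreviation "Imp \<phi> \<psi> \<equiv> Neg (Conj \<phi> (Neg \<psi>))"
abbreviation "Iff \<phi> \<psi> \<equiv> Conj (Imp \<phi> \<psi>) (Imp \<psi> \<phi>)"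
abbreviation "Forall i \<phi> \<equiv> Neg (Ex i (Neg \<phi>))"

text \<open>
  Variables are named, so every bound variable has to differ from the parameters.  Each formula below
  binds fixed small indices, and the lemma on its meaning requires the parameters to lie above them.
\<close>

definition upair_fm :: "nat \<Rightarrow> nat \<Rightarrow> nat \<Rightarrow> fm" where
  "upair_fm c a b = Forall 0 (Iff (Mem 0 c) (Disj (Equ 0 a) (Equ 0 b)))"

definition pair_fm :: "nat \<Rightarrow> nat \<Rightarrow> nat \<Rightarrow> fm" where
  "pair_fm p a b = Forall 1 (Iff (Mem 1 p) (Disj (upair_fm 1 a a) (upair_fm 1 a b)))"

definition related_fm :: "nat \<Rightarrow> nat \<Rightarrow> nat \<Rightarrow> fm" where
  "related_fm r a b = Ex 2 (Conj (Mem 2 r) (pair_fm 2 a b))"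

lemma sat_upair_fm:
  assumes "c > 0" "a > 0" "b > 0"
  shows "sat mem v (upair_fm c a b) \<longleftrightarrow> is_upair mem (v c) (v a) (v b)"
  using assms by (auto simp: upair_fm_def is_upair_def)

lemma sat_pair_fm:
  assumes "p > 1" "a > 1" "b > 1"
  shows "sat mem v (pair_fm p a b) \<longleftrightarrow> is_pair mem (v p) (v a) (v b)"
  using assms by (auto simp: pair_fm_def is_pair_def sat_upair_fm)

lemma sat_related_fm:
  assumes "r > 2" "a > 2" "b > 2"
  shows "sat mem v (related_fm r a b) \<longleftrightarrow> (v a, v b) \<in> rel_of mem (v r)"
  using assms by (auto simp: related_fm_def rel_of_def sat_pair_fm)

definition relation_fm :: "nat \<Rightarrow> fm" where
  "relation_fm r = Forall 3 (Imp (Mem 3 r) (Ex 4 (Ex 5 (pair_fm 3 4 5))))"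

text \<open>
  The last conjunct unfolds unique existence into a value that every value of the relation equals.
\<close>

definition map_fm :: "nat \<Rightarrow> nat \<Rightarrow> nat \<Rightarrow> fm" where
  "map_fm f X Y =
     Conj (relation_fm f)
       (Conj (Forall 3 (Forall 4 (Imp (related_fm f 3 4) (Conj (Mem 3 X) (Mem 4 Y)))))
         (Forall 3 (Imp (Mem 3 X)
           (Ex 4 (Conj (related_fm f 3 4) (Forall 5 (Imp (related_fm f 3 5) (Equ 5 4))))))))"

lemma sat_relation_fm:
  assumes "r > 5"
  shows "sat mem v (relation_fm r) \<longleftrightarrow> is_relation mem (v r)"
  using assms by (simp add: relation_fm_def is_relation_def sat_pair_fm)

lemma sat_map_fm:
  assumes "f > 5" "X > 5" "Y > 5"
  shows "sat mem v (map_fm f X Y) \<longleftrightarrow> is_map mem (v f) (v X) (v Y)"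
proof -
  have sub: "rel_of mem (v f) \<subseteq> ext mem (v X) \<times> ext mem (v Y) \<longleftrightarrow>
      (\<forall>a b. (a, b) \<in> rel_of mem (v f) \<longrightarrow> mem a (v X) \<and> mem b (v Y))"
    by (auto simp: ext_def)
  have ex1: "(\<forall>x\<in>ext mem (v X). \<exists>!y. (x, y) \<in> rel_of mem (v f)) \<longleftrightarrow>
      (\<forall>x. mem x (v X) \<longrightarrow>
        (\<exists>y. (x, y) \<in> rel_of mem (v f) \<and> (\<forall>z. (x, z) \<in> rel_of mem (v f) \<longrightarrow> z = y)))"
    by (simp add: ext_def Ex1_def)
  show ?thesis
    unfolding is_map_def sub ex1 using assms
    by (simp add: map_fm_def sat_relation_fm sat_related_fm)
qed

definition image_subset_fm :: "nat \<Rightarrow> nat \<Rightarrow> nat \<Rightarrow> fm" where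
  "image_subset_fm f E F =
     Forall 3 (Forall 4 (Forall 5 (Forall 6
       (Imp (Conj (related_fm E 3 4) (Conj (related_fm f 3 5) (related_fm f 4 6)))
         (related_fm F 5 6)))))"

lemma sat_image_subset_fm:
  assumes "f > 6" "E > 6" "F > 6"
  shows "sat mem v (image_subset_fm f E F) \<longleftrightarrow>
    (rel_of mem (v f))\<inverse> O rel_of mem (v E) O rel_of mem (v f) \<subseteq> rel_of mem (v F)"
  using assms by (auto simp: image_subset_fm_def sat_related_fm relcomp_unfold)

text \<open>
  An element of \<open>E\<close> that escapes \<open>F\<close> witnesses that the image of \<open>E\<close> is not contained in \<open>F\<close>.
\<close>

definition escapes :: "('u \<Rightarrow> 'u \<Rightarrow> bool) \<Rightarrow> 'u \<Rightarrow> 'u \<Rightarrow> 'u \<Rightarrow> bool" where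
  "escapes mem f F p \<longleftrightarrow>
     (\<exists>x y x' y'. is_pair mem p x y \<and> (x, x') \<in> rel_of mem f \<and> (y, y') \<in> rel_of mem f \<and>
        (x', y') \<notin> rel_of mem F)"

definition escapes_fm :: "nat \<Rightarrow> nat \<Rightarrow> nat \<Rightarrow> fm" where
  "escapes_fm f F p =
     Ex 3 (Ex 4 (Ex 5 (Ex 6
       (Conj (pair_fm p 3 4) (Conj (related_fm f 3 5)
         (Conj (related_fm f 4 6) (Neg (related_fm F 5 6))))))))"

lemma sat_escapes_fm:
  assumes "f > 6" "F > 6" "p > 6"
  shows "sat mem v (escapes_fm f F p) \<longleftrightarrow> escapes mem (v f) (v F) (v p)"
  using assms by (simp add: escapes_fm_def escapes_def sat_pair_fm sat_related_fm)

section \<open>Transfer\<close>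

text \<open>
  Without the unordered pairs \<open>{a}\<close> and \<open>{a, b}\<close> in the universe, an empty element would be
  a Kuratowski pair of any such \<open>a\<close> and \<open>b\<close>.
\<close>

lemma is_pair_inject:
  assumes upair: "\<And>a b. \<exists>c. is_upair mem c a b"
    and ab: "is_pair mem p a b" and cd: "is_pair mem p c d"
  shows "a = c \<and> b = d"
proof -
  have same: "is_upair mem z a a \<or> is_upair mem z a b \<longleftrightarrow>
      is_upair mem z c c \<or> is_upair mem z c d" for z
    using ab cd by (simp add: is_pair_def)
  have sets: "is_upair mem z x y \<longleftrightarrow> ext mem z = {x, y}" for z x y
    by (auto simp: is_upair_def ext_def)
  have "{a, a} = {c, c} \<or> {a, a} = {c, d}" "{a, b} = {c, c} \<or> {a, b} = {c, d}"
    "{c, c} = {a, a} \<or> {c, c} = {a, b}" "{c, d} = {a, a} \<or> {c, d} = {a, b}"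
    using same upair unfolding sets by metis+
  then show ?thesis
    by (auto simp: doubleton_eq_iff)
qed

context saturated_enlargement
begin

lemma star_mem_iff: "smem (star a) (star b) \<longleftrightarrow> mem a b"
  using transfer[of "(\<lambda>_. a)(1 := b)" "Mem 0 1"] by simp

lemma star_is_map_iff:
  "is_map smem (star f) (star X) (star Y) \<longleftrightarrow> is_map mem f X Y"
  using transfer[of "(\<lambda>_. f)(8 := X, 9 := Y)" "map_fm 7 8 9"] by (simp add: sat_map_fm)

lemma star_image_subset_iff:
  "(rel_of smem (star f))\<inverse> O rel_of smem (star E) O rel_of smem (star f) \<subseteq> rel_of smem (star F)
    \<longleftrightarrow> (rel_of mem f)\<inverse> O rel_of mem E O rel_of mem f \<subseteq> rel_of mem F"
  using transfer[of "(\<lambda>_. f)(8 := E, 9 := F)" "image_subset_fm 7 8 9"]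
  by (simp add: sat_image_subset_fm)

lemma star_pair_inject:
  assumes "is_pair smem p a b" "is_pair smem p c d"
  shows "a = c \<and> b = d"
proof -
  have "sat mem v (Forall 4 (Forall 5 (Ex 6 (upair_fm 6 4 5))))" for v
    using pairing by (simp add: sat_upair_fm is_upair_def)
  then have "\<exists>c. is_upair smem c a b" for a b
    unfolding transfer by (simp add: sat_upair_fm)
  then show ?thesis
    using is_pair_inject assms by metis
qed

text \<open>
  The escaping pairs in \<open>E\<close> form a set of the universe by separation, and transfer computes
  the extension of this set by the same condition.
\<close>

lemma escaping_set_exists:
  obtains A where "\<And>p. mem p A \<longleftrightarrow> mem p E \<and> escapes mem f F p"
    and "\<And>p. smem p (star A) \<longleftrightarrow> smem p (star E) \<and> escapes smem (star f) (star F) p"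
proof -
  obtain A where A: "\<forall>p. mem p A \<longleftrightarrow>
      mem p E \<and> sat mem (((\<lambda>_. f)(8 := F))(9 := p)) (escapes_fm 7 8 9)"
    using separation by metis
  then have mem_A: "mem p A \<longleftrightarrow> mem p E \<and> escapes mem f F p" for p
    by (simp add: sat_escapes_fm)
  have "sat mem ((\<lambda>_. f)(8 := F, 10 := E, 11 := A))
      (Forall 9 (Iff (Mem 9 11) (Conj (Mem 9 10) (escapes_fm 7 8 9))))"
    by (simp add: sat_escapes_fm mem_A)
  then have "smem p (star A) \<longleftrightarrow> smem p (star E) \<and> escapes smem (star f) (star F) p" for p
    unfolding transfer by (simp add: sat_escapes_fm) blast
  with mem_A show thesis by (rule that)
qed

end

section \<open>Maps and their values\<close>

lemma is_map_related_iff: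
  assumes "is_map mem f X Y"
  shows "(x, y) \<in> rel_of mem f \<longleftrightarrow> x \<in> ext mem X \<and> y = app mem f x"
proof
  assume xy: "(x, y) \<in> rel_of mem f"
  then have "x \<in> ext mem X"
    using assms by (auto simp: is_map_def)
  moreover from this have "\<exists>!y. (x, y) \<in> rel_of mem f"
    using assms by (simp add: is_map_def)
  ultimately show "x \<in> ext mem X \<and> y = app mem f x"
    using xy by (simp add: app_def the1_equality)
next
  assume x: "x \<in> ext mem X \<and> y = app mem f x"
  then have "\<exists>!y. (x, y) \<in> rel_of mem f"
    using assms by (simp add: is_map_def)
  then have "(x, app mem f x) \<in> rel_of mem f"
    unfolding app_def by (rule theI')
  with x show "(x, y) \<in> rel_of mem f" by simp
qed

lemma is_map_app_in:
  assumes "is_map mem f X Y" "x \<in> ext mem X"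
  shows "app mem f x \<in> ext mem Y"
proof -
  have "(x, app mem f x) \<in> rel_of mem f"
    using assms by (simp add: is_map_related_iff)
  then show ?thesis
    using assms(1) by (auto simp: is_map_def)
qed

text \<open>This turns the image of a relation into a form that mentions only the graph of the map.\<close>

lemma image_eq_relcomp:
  assumes "is_map mem f X Y" "E \<subseteq> ext mem X \<times> ext mem X"
  shows "{(app mem f x, app mem f y) | x y. (x, y) \<in> E} =
    (rel_of mem f)\<inverse> O E O rel_of mem f"
  using assms(2) by (auto simp: relcomp_unfold is_map_related_iff[OF assms(1)])

section \<open>Bornologous maps and finite closeness\<close>

context saturated_enlargement
begin

text \<open>
  This is where saturation enters: escaping each \<open>F\<close> separately becomes escaping all of them with
  one pair.  A pair that escapes a common upper bound of finitely many relations escapes each of them,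
  and this gives the finite intersection property.
\<close>

lemma uniform_escape:
  assumes map: "is_map mem f X Y"
    and bound: "\<And>\<F>. \<lbrakk>finite \<F>; \<F> \<subseteq> ext mem C\<rbrakk> \<Longrightarrow>
      \<exists>G\<in>ext mem C. \<forall>F\<in>\<F>. rel_of mem F \<subseteq> rel_of mem G"
    and escape: "\<And>F. F \<in> ext mem C \<Longrightarrow>
      \<not> (rel_of mem f)\<inverse> O rel_of mem E O rel_of mem f \<subseteq> rel_of mem F"
  obtains x y where "x \<in> ext smem (star X)" "y \<in> ext smem (star X)"
    and "(x, y) \<in> rel_of smem (star E)"
    and "(app smem (star f) x, app smem (star f) y) \<notin> finitely_close mem smem star C"
proof -
  have star_f: "is_map smem (star f) (star X) (star Y)"
    using map by (simp add: star_is_map_iff)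
  define E_escaping where "E_escaping F A \<longleftrightarrow>
      (\<forall>p. mem p A \<longleftrightarrow> mem p E \<and> escapes mem f F p) \<and>
      (\<forall>p. smem p (star A) \<longleftrightarrow> smem p (star E) \<and> escapes smem (star f) (star F) p)" for F A
  have "\<exists>A. E_escaping F A" for F
    unfolding E_escaping_def by (rule escaping_set_exists[of E f F]) blast
  then obtain A where "\<And>F. E_escaping F (A F)"
    by metis
  then have mem_A: "mem p (A F) \<longleftrightarrow> mem p E \<and> escapes mem f F p"
    and smem_A: "smem q (star (A F)) \<longleftrightarrow> smem q (star E) \<and> escapes smem (star f) (star F) q"
    for F p q
    unfolding E_escaping_def by blast+
  have "(\<lambda>F. star (A F)) ` ext mem C \<lesssim> ext mem C"
    by (rule image_lepoll)
  also have "\<dots> \<lesssim> (UNIV :: 'u set)"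
    by (rule subset_imp_lepoll) simp
  finally have small: "(\<lambda>F. star (A F)) ` ext mem C \<lesssim> (UNIV :: 'u set)" .
  have "\<exists>p. \<forall>B\<in>\<B>. smem p B" if \<B>: "\<B> \<subseteq> (\<lambda>F. star (A F)) ` ext mem C" "finite \<B>" for \<B>
  proof -
    obtain \<F> where \<F>: "\<F> \<subseteq> ext mem C" "finite \<F>" "\<B> = (\<lambda>F. star (A F)) ` \<F>"
      using finite_subset_image[OF \<B>(2,1)] by blast
    then obtain G where G: "G \<in> ext mem C" "\<And>F. F \<in> \<F> \<Longrightarrow> rel_of mem F \<subseteq> rel_of mem G"
      using bound by meson
    obtain x y x' y' where xy: "(x, y) \<in> rel_of mem E" "(x, x') \<in> rel_of mem f"
        "(y, y') \<in> rel_of mem f" "(x', y') \<notin> rel_of mem G"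
      using escape[OF G(1)] by (auto simp: relcomp_unfold)
    then obtain p where p: "mem p E" "is_pair mem p x y"
      by (auto simp: rel_of_def)
    have "mem p (A F)" if "F \<in> \<F>" for F
    proof -
      have "(x', y') \<notin> rel_of mem F"
        using xy(4) G(2)[OF that] by blast
      with xy(2,3) p show ?thesis
        by (auto simp: mem_A escapes_def)
    qed
    then have "\<forall>B\<in>\<B>. smem (star p) B"
      by (simp add: \<F>(3) star_mem_iff)
    then show ?thesis ..
  qed
  then obtain p where p: "\<And>F. F \<in> ext mem C \<Longrightarrow> smem p (star (A F))"
    using saturation[OF small] by auto
  obtain F\<^sub>0 where "F\<^sub>0 \<in> ext mem C"
    using bound[of "{}"] by auto
  then have "smem p (star E)" "escapes smem (star f) (star F\<^sub>0) p"
    using p by (auto simp: smem_A)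
  then obtain x y where pE: "smem p (star E)" and pair: "is_pair smem p x y"
    and xX: "x \<in> ext smem (star X)" and yX: "y \<in> ext smem (star X)"
    by (auto simp: escapes_def is_map_related_iff[OF star_f])
  have "(app smem (star f) x, app smem (star f) y) \<notin> rel_of smem (star F)"
    if F: "F \<in> ext mem C" for F
  proof -
    have "escapes smem (star f) (star F) p"
      using p[OF F] by (simp add: smem_A)
    \<comment> \<open>The entries provided here are the same for all \<open>F\<close>, because \<open>p\<close> determines them.\<close>
    then obtain u w where "is_pair smem p u w"
      and "(app smem (star f) u, app smem (star f) w) \<notin> rel_of smem (star F)"
      by (auto simp: escapes_def is_map_related_iff[OF star_f])
    then show ?thesis
      using star_pair_inject[OF pair] by metis
  qed
  then have "(app smem (star f) x, app smem (star f) y) \<notin> finitely_close mem smem star C"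
    by (auto simp: finitely_close_def)
  moreover have "(x, y) \<in> rel_of smem (star E)"
    using pE pair by (auto simp: rel_of_def)
  ultimately show thesis
    using xX yX that by blast
qed

lemma bornologous_iff_finitely_close:
  assumes X: "coarse_space mem X CX" and Y: "coarse_space mem Y CY" and map: "is_map mem f X Y"
  shows "bornologous (controlled mem CX) (controlled mem CY) (app mem f) \<longleftrightarrow>
    (\<forall>x \<in> ext smem (star X). \<forall>y \<in> ext smem (star X).
       (x, y) \<in> finitely_close mem smem star CX \<longrightarrow>
       (app smem (star f) x, app smem (star f) y) \<in> finitely_close mem smem star CY)"
    (is "?born \<longleftrightarrow> ?close")
proof -
  have star_f: "is_map smem (star f) (star X) (star Y)"
    using map by (simp add: star_is_map_iff)
  have "rel_of mem E \<subseteq> ext mem X \<times> ext mem X" if "E \<in> ext mem CX" for E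
    using X that by (auto simp: coarse_space_def coarse_structure_def controlled_def)
  note image = image_eq_relcomp[OF map this]
  show ?thesis
  proof
    assume born: ?born
    show ?close
    proof (intro ballI impI)
      fix x y
      assume xX: "x \<in> ext smem (star X)" and yX: "y \<in> ext smem (star X)"
        and "(x, y) \<in> finitely_close mem smem star CX"
      then obtain E where E: "E \<in> ext mem CX" "(x, y) \<in> rel_of smem (star E)"
        by (auto simp: finitely_close_def)
      have "(rel_of mem f)\<inverse> O rel_of mem E O rel_of mem f \<in> controlled mem CY"
        unfolding image[OF E(1), symmetric]
        using born E(1) by (simp add: bornologous_def controlled_def)
      then obtain F where F: "F \<in> ext mem CY"
        and "(rel_of mem f)\<inverse> O rel_of mem E O rel_of mem f \<subseteq> rel_of mem F"
        by (auto simp: controlled_def)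
      then have "(rel_of smem (star f))\<inverse> O rel_of smem (star E) O rel_of smem (star f)
          \<subseteq> rel_of smem (star F)"
        by (simp add: star_image_subset_iff)
      moreover have "(x, app smem (star f) x) \<in> rel_of smem (star f)"
        "(y, app smem (star f) y) \<in> rel_of smem (star f)"
        using xX yX by (simp_all add: is_map_related_iff[OF star_f])
      ultimately have "(app smem (star f) x, app smem (star f) y) \<in> rel_of smem (star F)"
        using E(2) by blast
      with F show "(app smem (star f) x, app smem (star f) y) \<in> finitely_close mem smem star CY"
        by (auto simp: finitely_close_def)
    qed
  next
    assume close: ?close
    show ?born
      unfolding bornologous_def
    proof (rule ballI, rule ccontr)
      fix R
      assume "R \<in> controlled mem CX"
        and not_controlled: "{(app mem f x, app mem f y) | x y. (x, y) \<in> R} \<notin> controlled mem CY"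
      then obtain E where E: "E \<in> ext mem CX" "R = rel_of mem E"
        by (auto simp: controlled_def)
      have escape: "\<not> (rel_of mem f)\<inverse> O rel_of mem E O rel_of mem f \<subseteq> rel_of mem F"
        if "F \<in> ext mem CY" for F
      proof
        assume "(rel_of mem f)\<inverse> O rel_of mem E O rel_of mem f \<subseteq> rel_of mem F"
        moreover have "rel_of mem F \<in> controlled mem CY"
          using that by (simp add: controlled_def)
        ultimately have "(rel_of mem f)\<inverse> O rel_of mem E O rel_of mem f \<in> controlled mem CY"
          using Y unfolding coarse_space_def coarse_structure_def by blast
        with not_controlled show False
          by (simp add: E(2) image[OF E(1)])
      qed
      have bound: "\<exists>G\<in>ext mem CY. \<forall>F\<in>\<F>. rel_of mem F \<subseteq> rel_of mem G"
        if "finite \<F>" "\<F> \<subseteq> ext mem CY" for \<F>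
      proof -
        have "rel_of mem ` \<F> \<subseteq> controlled mem CY" "finite (rel_of mem ` \<F>)"
          using that by (auto simp: controlled_def)
        then have "\<Union>(rel_of mem ` \<F>) \<in> controlled mem CY"
          using Y unfolding coarse_space_def coarse_structure_def by blast
        then obtain G where "G \<in> ext mem CY" "rel_of mem G = \<Union>(rel_of mem ` \<F>)"
          by (auto simp: controlled_def)
        then show ?thesis by blast
      qed
      obtain x y where "x \<in> ext smem (star X)" "y \<in> ext smem (star X)"
        and "(x, y) \<in> rel_of smem (star E)"
        and "(app smem (star f) x, app smem (star f) y) \<notin> finitely_close mem smem star CY"
        using uniform_escape[OF map bound escape] by blast
      moreover from this have "(x, y) \<in> finitely_close mem smem star CX"
        using E(1) by (auto simp: finitely_close_def)
      ultimately show False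
        using close by blast
    qed
  qed
qed

lemma finitely_close_iff_galaxy:
  assumes map: "is_map mem f X Y"
  shows "(\<forall>x \<in> ext smem (star X). \<forall>y \<in> ext smem (star X).
       (x, y) \<in> finitely_close mem smem star CX \<longrightarrow>
       (app smem (star f) x, app smem (star f) y) \<in> finitely_close mem smem star CY) \<longleftrightarrow>
    (\<forall>x \<in> ext smem (star X).
       app smem (star f) ` coarse_galaxy mem smem star X CX x
         \<subseteq> coarse_galaxy mem smem star Y CY (app smem (star f) x))"
proof -
  have "app smem (star f) y \<in> ext smem (star Y)" if "y \<in> ext smem (star X)" for y
    using is_map_app_in that map by (metis star_is_map_iff)
  then show ?thesis
    by (auto simp: coarse_galaxy_def image_subset_iff)
qed

end

theorem theorem3p23:
  fixes mem :: "'u \<Rightarrow> 'u \<Rightarrow> bool"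
    and smem :: "'v \<Rightarrow> 'v \<Rightarrow> bool"
    and star :: "'u \<Rightarrow> 'v"
    and X CX Y CY f :: 'u
  assumes "saturated_enlargement mem smem star"
    and "coarse_space mem X CX"
    and "coarse_space mem Y CY"
    and "is_map mem f X Y"
  shows "(bornologous (controlled mem CX) (controlled mem CY) (app mem f) \<longleftrightarrow>
          (\<forall>x \<in> ext smem (star X). \<forall>y \<in> ext smem (star X).
             (x, y) \<in> finitely_close mem smem star CX \<longrightarrow>
             (app smem (star f) x, app smem (star f) y) \<in> finitely_close mem smem star CY))
       \<and> ((\<forall>x \<in> ext smem (star X). \<forall>y \<in> ext smem (star X).
             (x, y) \<in> finitely_close mem smem star CX \<longrightarrow>
             (app smem (star f) x, app smem (star f) y) \<in> finitely_close mem smem star CY) \<longleftrightarrow>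
          (\<forall>x \<in> ext smem (star X).
             app smem (star f) ` coarse_galaxy mem smem star X CX x
               \<subseteq> coarse_galaxy mem smem star Y CY (app smem (star f) x)))"
proof -
  interpret saturated_enlargement mem smem star
    by (rule assms(1))
  show ?thesis
    using bornologous_iff_finitely_close[OF assms(2-4)] finitely_close_iff_galaxy[OF assms(4)]
    by (rule conjI)
qed

end
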